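(* Let $p\in\mathcal{H}_{n,d}(e)$ be a product of distinct linear forms, i.e. $p(x)=\prod_{i=1}^da_i[x]$ where $a_1,\ldots,a_d\in(\mathbb{R}^n)^*$ satisfy $a_i[e]>0$ for all $i$ and $a_i\ne a_j$ for all $i\ne j$. Then $\phi_{p,e}(\mathbb{R}^n,\mathbb{R}^d)=\Lambda_+(p,e)^*$.
   Context: A homogeneous polynomial $p\in\mathbb{R}[x_1,\ldots,x_n]$ of degree $d$ is hyperbolic with respect to $e\in\mathbb{R}^n$ if $p(e)>0$ and for every $x\in\mathbb{R}^n$ the polynomial $t\mapsto p(x+te)$ has only real zeros; $\mathcal{H}_{n,d}(e)$ is the set of such polynomials. The hyperbolicity cone $\Lambda_+(p,e)$ is the set of $x\in\mathbb{R}^n$ such that all zeros of $t\mapsto p(te-x)$ are nonnegative, and its dual cone is $\Lambda_+(p,e)^*=\{\xi\in(\mathbb{R}^n)^*:\xi[x]\ge0\text{ for all }x\in\Lambda_+(p,e)\}$. For $x,u\in\mathbb{R}^n$ put $p_x(t)=p(x+te)$ and $D_up_x(t)=(D_up)(x+te)$, with $D_u$ the directional derivative. The parameterized Hermite matrix $H_{p,e}(x)[u]$ is the $d\times d$ Hankel matrix $[h_{i+j-1}]_{i,j=1}^d$, where $\frac{D_up_x(t)}{p_x(t)}=\sum_{k\ge1}h_kt^{-k}$ (expansion at infinity); it is linear in $u$. For $(x,y)\in\mathbb{R}^n\times\mathbb{R}^d$, $\phi_{p,e}(x,y)\in(\mathbb{R}^n)^*$ is the linear functional $\phi_{p,e}(x,y)[u]=y^TH_{p,e}(x)[u]\,y$,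 and $\phi_{p,e}(\mathbb{R}^n,\mathbb{R}^d)$ is its image. *)

theory Defs
  imports
    "HOL-Analysis.Analysis"
    "HOL-Computational_Algebra.Polynomial"
    "Jordan_Normal_Form.Matrix"
begin

text \<open>
  Polynomials in \<open>\<real>[x\<^sub>1,\<dots>,x\<^sub>n]\<close> are identified with the functions on \<open>\<real>\<^sup>n\<close> that they induce
  (harmless over an infinite field).  The exponent vectors of total degree \<open>d\<close> form a finite set,
  so the sum below is a genuine finite sum.
\<close>

definition homogeneous_polynomial :: "nat \<Rightarrow> (real ^ 'n \<Rightarrow> real) \<Rightarrow> bool" where
  "homogeneous_polynomial d p \<longleftrightarrow>
     (\<exists>c :: ('n \<Rightarrow> nat) \<Rightarrow> real. \<forall>x.
        p x = (\<Sum>\<alpha> | (\<Sum>i\<in>UNIV. \<alpha> i) = d. c \<alpha> * (\<Prod>i\<in>UNIV. (x $ i) ^ \<alpha> i)))"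

text \<open>
  The univariate polynomial \<open>t \<mapsto> p (x + t e)\<close>, needed as an element of \<open>\<real>[t]\<close> in order to speak
  about its complex zeros.  For polynomial \<open>p\<close> it exists, and it is always unique.
\<close>

definition line_poly :: "(real ^ 'n \<Rightarrow> real) \<Rightarrow> real ^ 'n \<Rightarrow> real ^ 'n \<Rightarrow> real poly" where
  "line_poly p e x = (THE q. \<forall>t. poly q t = p (x + t *\<^sub>R e))"

definition real_rooted :: "real poly \<Rightarrow> bool" where
  "real_rooted q \<longleftrightarrow> (\<forall>z :: complex. poly (map_poly complex_of_real q) z = 0 \<longrightarrow> z \<in> \<real>)"

definition hyperbolic_polys :: "nat \<Rightarrow> real ^ 'n \<Rightarrow> (real ^ 'n \<Rightarrow> real) set" where
  "hyperbolic_polys d e =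
     {p. homogeneous_polynomial d p \<and> p e > 0 \<and> (\<forall>x. real_rooted (line_poly p e x))}"

text \<open>
  It suffices to let \<open>t\<close> range over the reals, because for hyperbolic \<open>p\<close> the polynomial
  \<open>t \<mapsto> p (t e - x)\<close> has no other zeros.
\<close>

definition hyperbolicity_cone :: "(real ^ 'n \<Rightarrow> real) \<Rightarrow> real ^ 'n \<Rightarrow> (real ^ 'n) set" where
  "hyperbolicity_cone p e = {x. \<forall>t :: real. p (t *\<^sub>R e - x) = 0 \<longrightarrow> t \<ge> 0}"

definition dual_cone :: "(real ^ 'n) set \<Rightarrow> (real ^ 'n \<Rightarrow> real) set" where
  "dual_cone K = {\<xi>. linear \<xi> \<and> (\<forall>x\<in>K. \<xi> x \<ge> 0)}"

definition dir_deriv :: "real ^ 'n \<Rightarrow> (real ^ 'n \<Rightarrow> real) \<Rightarrow> real ^ 'n \<Rightarrow> real" where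
  "dir_deriv u p x = deriv (\<lambda>s :: real. p (x + s *\<^sub>R u)) 0"

text \<open>
  The coefficients \<open>h\<^sub>k\<close>, \<open>k \<ge> 1\<close>, of the expansion of \<open>D\<^sub>u p\<^sub>x (t) / p\<^sub>x (t)\<close> in powers of \<open>1 / t\<close>
  for large \<open>\<bar>t\<bar>\<close>.  The series has no constant term; fixing \<open>h 0 = 0\<close> makes the sequence unique.
\<close>

definition hermite_coeffs ::
    "(real ^ 'n \<Rightarrow> real) \<Rightarrow> real ^ 'n \<Rightarrow> real ^ 'n \<Rightarrow> real ^ 'n \<Rightarrow> nat \<Rightarrow> real" where
  "hermite_coeffs p e x u =
     (THE h. h 0 = 0 \<and>
        (\<forall>\<^sub>F t in at_infinity.
           (\<lambda>k. h k * inverse t ^ k) sums (dir_deriv u p (x + t *\<^sub>R e) / p (x + t *\<^sub>R e))))"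

text \<open>
  Matrix entries are indexed from \<open>0\<close>, so the Hankel entry \<open>h\<^bsub>i+j-1\<^esub>\<close> with \<open>1 \<le> i, j \<le> d\<close> becomes
  \<open>h\<^bsub>i+j+1\<^esub>\<close> with \<open>0 \<le> i, j < d\<close>.
\<close>

definition hermite_matrix ::
    "nat \<Rightarrow> (real ^ 'n \<Rightarrow> real) \<Rightarrow> real ^ 'n \<Rightarrow> real ^ 'n \<Rightarrow> real ^ 'n \<Rightarrow> real mat" where
  "hermite_matrix d p e x u = mat d d (\<lambda>(i, j). hermite_coeffs p e x u (i + j + 1))"

definition hermite_map ::
    "nat \<Rightarrow> (real ^ 'n \<Rightarrow> real) \<Rightarrow> real ^ 'n \<Rightarrow> real ^ 'n \<Rightarrow> real Matrix.vec \<Rightarrow> (real ^ 'n \<Rightarrow> real)"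
  where
  "hermite_map d p e x y = (\<lambda>u. scalar_prod y (mult_mat_vec (hermite_matrix d p e x u) y))"

end

theory Submission
  imports Defs "HOL-Complex_Analysis.Cauchy_Integral_Formula"
begin

text \<open>
  Normalise the forms to \<open>b\<^sub>i = a\<^sub>i / a\<^sub>i[e]\<close>.  The zeros of \<open>t \<mapsto> p (t e - x)\<close> are the numbers
  \<open>b\<^sub>i[x]\<close>, so the hyperbolicity cone is the polyhedral cone \<open>{x. \<forall>i. b\<^sub>i[x] \<ge> 0}\<close>, and by Farkas'
  lemma its dual consists of the nonnegative combinations of the \<open>b\<^sub>i\<close>.

  The logarithmic derivative of a product of linear forms is a sum of simple fractions,
  \<open>D\<^sub>u p\<^sub>x(t) / p\<^sub>x(t) = (\<Sum>i. b\<^sub>i[u] / (t + b\<^sub>i[x]))\<close>.  Expanding them as geometric series gives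
  \<open>h\<^sub>k = (\<Sum>i. b\<^sub>i[u] (- b\<^sub>i[x])\<^bsup>k-1\<^esup>)\<close>, hence
  \<open>\<phi>(x, y) = (\<Sum>i. q\<^sub>y(- b\<^sub>i[x])\<^sup>2 b\<^sub>i)\<close> with \<open>q\<^sub>y(t) = (\<Sum>j<d. y\<^sub>j t\<^sup>j)\<close>
  (lemma \<open>hermite_map_prod_linear\<close>).  So \<open>\<phi>\<close> takes its values in the dual cone.

  For the converse let \<open>\<xi> = (\<Sum>i. c\<^sub>i b\<^sub>i)\<close> with \<open>c\<^sub>i \<ge> 0\<close>.  Different forms \<open>a\<^sub>i\<close> may be proportional,
  in which case their \<open>b\<^sub>i\<close> agree; averaging the coefficients over indices with the same form, one
  may assume that \<open>c\<^sub>i\<close> depends on \<open>b\<^sub>i\<close> only.  A point \<open>x\<close> off finitely many hyperplanes separates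
  the different \<open>b\<^sub>i\<close>, and a polynomial of degree less than \<open>d\<close> interpolates the values
  \<open>sqrt c\<^sub>i\<close> at the nodes \<open>- b\<^sub>i[x]\<close>; its coefficient vector is the required \<open>y\<close>.
\<close>

section \<open>Finitely generated cones\<close>

lemma farkas:
  fixes v :: "'i \<Rightarrow> 'a::euclidean_space" and z :: 'a
  assumes fin: "finite I"
    and pos: "\<And>x. (\<And>i. i \<in> I \<Longrightarrow> inner (v i) x \<ge> 0) \<Longrightarrow> inner z x \<ge> 0"
  obtains c where "\<And>i. i \<in> I \<Longrightarrow> c i \<ge> (0::real)" "z = (\<Sum>i\<in>I. c i *\<^sub>R v i)"
proof -
  define K where "K = convex_cone hull (v ` I)"
  define L where "L = {w. \<exists>c. (\<forall>i\<in>I. c i \<ge> (0::real)) \<and> w = (\<Sum>i\<in>I. c i *\<^sub>R v i)}"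
  have cone: "convex_cone K"
    unfolding K_def by (rule convex_cone_convex_cone_hull)
  have vK: "v i \<in> K" if "i \<in> I" for i
    unfolding K_def using that by (simp add: hull_inc)
  have "convex_cone L"
    unfolding convex_cone_iff
  proof (intro conjI ballI allI impI)
    show "0 \<in> L"
      unfolding L_def by (auto intro!: exI[of _ "\<lambda>_. 0"])
  next
    fix x y assume "x \<in> L" "y \<in> L"
    then obtain c c' where "\<forall>i\<in>I. c i \<ge> 0" "x = (\<Sum>i\<in>I. c i *\<^sub>R v i)"
      "\<forall>i\<in>I. c' i \<ge> 0" "y = (\<Sum>i\<in>I. c' i *\<^sub>R v i)"
      unfolding L_def by auto
    then show "x + y \<in> L"
      unfolding L_def by (auto intro!: exI[of _ "\<lambda>i. c i + c' i"] simp: sum.distrib scaleR_add_left)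
  next
    fix x and r :: real assume "x \<in> L" "r \<ge> 0"
    then obtain c where "\<forall>i\<in>I. c i \<ge> 0" "x = (\<Sum>i\<in>I. c i *\<^sub>R v i)"
      unfolding L_def by auto
    with \<open>r \<ge> 0\<close> show "r *\<^sub>R x \<in> L"
      unfolding L_def by (auto intro!: exI[of _ "\<lambda>i. r * c i"] simp: scaleR_sum_right)
  qed
  moreover have "v i \<in> L" if "i \<in> I" for i
    unfolding L_def using that fin
    by (auto intro!: exI[of _ "\<lambda>j. if j = i then 1 else 0"] simp: if_distrib[of "\<lambda>r. r *\<^sub>R _"] cong: if_cong)
  ultimately have "K \<subseteq> L"
    unfolding K_def by (intro hull_minimal) auto
  have "z \<in> K"
  proof (rule ccontr)
    assume "z \<notin> K"
    moreover have "closed K" "convex K"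
      unfolding K_def using fin
      by (auto intro: polyhedron_imp_closed polyhedron_convex_cone_hull convex_convex_cone_hull)
    ultimately obtain x r where x: "inner x z < r" "\<And>w. w \<in> K \<Longrightarrow> inner x w > r"
      using separating_hyperplane_closed_point[of K z] by blast
    have "r < 0"
      using x(2)[OF convex_cone_contains_0[OF cone]] by simp
    have "inner (v i) x \<ge> 0" if "i \<in> I" for i
    proof (rule ccontr)
      assume neg: "\<not> inner (v i) x \<ge> 0"
      \<comment> \<open>the multiple of \<open>v i\<close> on which the functional takes the value \<open>r\<close>\<close>
      have "(r / inner x (v i)) *\<^sub>R v i \<in> K"
        using neg \<open>r < 0\<close> vK[OF that]
        by (intro convex_cone_scaleR[OF cone]) (auto simp: inner_commute intro: divide_nonpos_nonpos)
      from x(2)[OF this] neg show False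
        by (auto simp: inner_commute)
    qed
    then have "inner z x \<ge> 0"
      by (rule pos)
    with x(1) \<open>r < 0\<close> show False
      by (simp add: inner_commute)
  qed
  with \<open>K \<subseteq> L\<close> that show ?thesis
    unfolding L_def by blast
qed

lemma linear_real_inner:
  fixes f :: "'a::euclidean_space \<Rightarrow> real"
  assumes "linear f"
  obtains w where "\<And>x. f x = inner w x"
proof
  show "f x = inner (adjoint f 1) x" for x
    using adjoint_works[OF assms, of x 1] by (simp add: inner_commute)
qed

section \<open>Separating points and interpolation\<close>

lemma ex_separating_point:
  fixes v :: "'i \<Rightarrow> 'a::euclidean_space"
  assumes "finite I"
  obtains x where "\<And>i j. i \<in> I \<Longrightarrow> j \<in> I \<Longrightarrow> inner (v i) x = inner (v j) x \<Longrightarrow> v i = v j"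
proof -
  define H where "H = (\<lambda>(i, j). {x. inner (v i - v j) x = 0}) ` {(i, j) \<in> I \<times> I. v i \<noteq> v j}"
  have "finite {(i, j) \<in> I \<times> I. v i \<noteq> v j}"
    by (rule finite_subset[of _ "I \<times> I"]) (use assms in auto)
  then have "negligible (\<Union>H)"
    unfolding H_def by (intro negligible_Union) (auto intro!: negligible_hyperplane)
  then have "\<Union>H \<noteq> UNIV"
    by force
  then obtain x where "x \<notin> \<Union>H"
    by blast
  then show ?thesis
    by (intro that[of x]) (auto simp: H_def inner_diff_left)
qed

lemma poly_interpolation:
  fixes f :: "'a::field \<Rightarrow> 'a"
  assumes "finite A"
  shows "\<exists>q. (\<forall>k\<ge>card A. coeff q k = 0) \<and> (\<forall>s\<in>A. poly q s = f s)"
  using assms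
proof (induction A)
  case empty
  show ?case by (auto intro!: exI[of _ 0])
next
  case (insert r A)
  then obtain q where q: "\<And>k. k \<ge> card A \<Longrightarrow> coeff q k = 0" "\<And>s. s \<in> A \<Longrightarrow> poly q s = f s"
    by blast
  define N where "N = (\<Prod>s\<in>A. [:- s, 1:])"
  have N: "poly N x = (\<Prod>s\<in>A. x - s)" for x
    unfolding N_def by (simp add: poly_prod)
  have "degree N = card A"
    unfolding N_def by (subst degree_prod_eq_sum_degree) auto
  moreover have "poly N r \<noteq> 0" "\<And>s. s \<in> A \<Longrightarrow> poly N s = 0"
    using insert.hyps by (auto simp: N)
  ultimately show ?case
    using insert.hyps q
    by (intro exI[of _ "q + Polynomial.smult ((f r - poly q r) / poly N r) N"]) (auto simp: coeff_eq_0)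
qed

section \<open>Coefficients of the logarithmic derivative\<close>

text \<open>
  The uniqueness of an expansion in \<open>1 / t\<close> with given constant term.
\<close>

lemma expansion_at_infinity_unique:
  fixes g h :: "nat \<Rightarrow> real"
  assumes "g 0 = h 0"
    and g: "\<forall>\<^sub>F t in at_infinity. (\<lambda>k. g k * inverse t ^ k) sums f t"
    and h: "\<forall>\<^sub>F t in at_infinity. (\<lambda>k. h k * inverse t ^ k) sums f t"
  shows "g = h"
proof -
  from eventually_conj[OF g h] obtain B where
    B: "\<And>t. norm t \<ge> B \<Longrightarrow> (\<lambda>k. g k * inverse t ^ k) sums f t \<and> (\<lambda>k. h k * inverse t ^ k) sums f t"
    unfolding eventually_at_infinity by blast
  define C where "C = max B 1"
  have "C > 0"
    by (simp add: C_def)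
  have diff: "(\<lambda>k. (g k - h k) * (z - 0) ^ k) sums 0" if "norm (z - 0) < inverse C" for z
  proof (cases "z = 0")
    case True
    with \<open>g 0 = h 0\<close> have "(\<lambda>k. (g k - h k) * (z - 0) ^ k) = (\<lambda>_. 0)"
      by (auto simp: power_0_left)
    then show ?thesis
      by (simp only: sums_zero)
  next
    case False
    then have "C \<le> \<bar>inverse z\<bar>"
      using that \<open>C > 0\<close> by (simp add: field_simps)
    then have "norm (inverse z) \<ge> B"
      by (simp add: C_def)
    from B[OF this] show ?thesis
      using sums_diff[of "\<lambda>k. g k * z ^ k" "f (inverse z)" "\<lambda>k. h k * z ^ k" "f (inverse z)"]
      by (simp add: left_diff_distrib)
  qed
  show ?thesis
  proof (rule ccontr)
    assume "g \<noteq> h"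
    then obtain m where "g m - h m \<noteq> 0"
      by auto
    moreover from this have "m > 0"
      using \<open>g 0 = h 0\<close> by (cases m) auto
    ultimately obtain s where "s > 0" "\<And>z::real. z \<in> cball 0 s - {0} \<Longrightarrow> (0::real) \<noteq> 0"
      using powser_0_nonzero[of "inverse C" 0 "\<lambda>k. g k - h k" "\<lambda>_. 0" m] diff \<open>C > 0\<close> by auto
    then show False
      by (metis DiffI empty_iff insert_iff less_eq_real_def mem_cball_0 not_less real_norm_def abs_of_pos)
  qed
qed

lemma hermite_coeffs_eqI:
  assumes "h 0 = 0"
    and "\<forall>\<^sub>F t in at_infinity.
           (\<lambda>k. h k * inverse t ^ k) sums (dir_deriv u p (x + t *\<^sub>R e) / p (x + t *\<^sub>R e))"
  shows "hermite_coeffs p e x u = h"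
  unfolding hermite_coeffs_def
  by (rule the_equality) (use assms in \<open>auto intro!: expansion_at_infinity_unique[rotated]\<close>)

lemma dir_deriv_prod_linear:
  assumes lin: "\<And>i. i \<in> I \<Longrightarrow> linear (a i)"
    and nz: "\<And>i. i \<in> I \<Longrightarrow> a i z \<noteq> 0"
  shows "dir_deriv u (\<lambda>x. \<Prod>i\<in>I. a i x) z = (\<Prod>i\<in>I. a i z) * (\<Sum>i\<in>I. a i u / a i z)"
proof -
  have eq: "(\<Prod>i\<in>I. a i (z + s *\<^sub>R u)) = (\<Prod>i\<in>I. a i z + s * a i u)" for s
    using lin by (intro prod.cong) (auto simp: linear_add linear_scale)
  have "((\<lambda>s. \<Prod>i\<in>I. a i z + s * a i u) has_field_derivative
      (\<Prod>i\<in>I. a i z + 0 * a i u) * (\<Sum>i\<in>I. a i u / (a i z + 0 * a i u))) (at 0)"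
    using nz by (intro has_field_derivative_prod') (auto intro!: derivative_eq_intros)
  then show ?thesis
    unfolding dir_deriv_def eq by (simp add: DERIV_imp_deriv)
qed

lemma sums_simple_fraction:
  fixes \<theta> t :: real
  assumes "\<bar>\<theta>\<bar> < \<bar>t\<bar>"
  shows "(\<lambda>k. (if k = 0 then 0 else \<theta> ^ (k - 1)) * inverse t ^ k) sums (1 / (t - \<theta>))"
proof -
  have "t \<noteq> 0" "t \<noteq> \<theta>"
    using assms by auto
  have "(\<lambda>k. inverse t * (\<theta> / t) ^ k) sums (inverse t * (1 / (1 - \<theta> / t)))"
    using assms by (intro sums_mult geometric_sums) (auto simp: field_simps)
  also have "inverse t * (1 / (1 - \<theta> / t)) = 1 / (t - \<theta>)"
    using \<open>t \<noteq> 0\<close> \<open>t \<noteq> \<theta>\<close> by (simp add: field_simps)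
  finally have "(\<lambda>k. (if Suc k = 0 then 0 else \<theta> ^ (Suc k - 1)) * inverse t ^ Suc k) sums (1 / (t - \<theta>))"
    by (simp add: field_simps power_divide)
  from sums_Suc[OF this] show ?thesis
    by simp
qed

lemma hermite_coeffs_prod_linear:
  fixes a :: "'i \<Rightarrow> real ^ 'n \<Rightarrow> real"
  assumes fin: "finite I"
    and lin: "\<And>i. i \<in> I \<Longrightarrow> linear (a i)"
    and pos: "\<And>i. i \<in> I \<Longrightarrow> a i e > 0"
  shows "hermite_coeffs (\<lambda>x. \<Prod>i\<in>I. a i x) e x u (Suc k)
       = (\<Sum>i\<in>I. a i u / a i e * (- (a i x / a i e)) ^ k)"
proof -
  define \<theta> where "\<theta> i = - (a i x / a i e)" for i
  define h where "h k = (\<Sum>i\<in>I. a i u / a i e * (if k = 0 then 0 else \<theta> i ^ (k - 1)))" for k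
  have "hermite_coeffs (\<lambda>x. \<Prod>i\<in>I. a i x) e x u = h"
  proof (rule hermite_coeffs_eqI)
    show "h 0 = 0"
      by (simp add: h_def)
  next
    show "\<forall>\<^sub>F t in at_infinity. (\<lambda>k. h k * inverse t ^ k) sums
        (dir_deriv u (\<lambda>x. \<Prod>i\<in>I. a i x) (x + t *\<^sub>R e) / (\<Prod>i\<in>I. a i (x + t *\<^sub>R e)))"
      unfolding eventually_at_infinity
    proof (intro exI allI impI)
      fix t :: real
      assume t: "norm t \<ge> 1 + (\<Sum>i\<in>I. \<bar>\<theta> i\<bar>)"
      have small: "\<bar>\<theta> i\<bar> < \<bar>t\<bar>" if "i \<in> I" for i
        using member_le_sum[of i I "\<lambda>i. \<bar>\<theta> i\<bar>"] that fin t by auto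
      have val: "a i (x + t *\<^sub>R e) = a i e * (t - \<theta> i)" if "i \<in> I" for i
        using lin[OF that] pos[OF that] by (simp add: linear_add linear_scale \<theta>_def field_simps)
      have nz: "a i (x + t *\<^sub>R e) \<noteq> 0" if "i \<in> I" for i
        using val[OF that] small[OF that] pos[OF that] by auto
      have "(\<lambda>k. \<Sum>i\<in>I. a i u / a i e * ((if k = 0 then 0 else \<theta> i ^ (k - 1)) * inverse t ^ k))
          sums (\<Sum>i\<in>I. a i u / a i e * (1 / (t - \<theta> i)))"
        by (intro sums_sum sums_mult sums_simple_fraction small)
      also have "(\<Sum>i\<in>I. a i u / a i e * (1 / (t - \<theta> i))) = (\<Sum>i\<in>I. a i u / a i (x + t *\<^sub>R e))"
        by (intro sum.cong) (auto simp: val)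
      also have "\<dots> = dir_deriv u (\<lambda>x. \<Prod>i\<in>I. a i x) (x + t *\<^sub>R e) / (\<Prod>i\<in>I. a i (x + t *\<^sub>R e))"
        using nz fin by (subst dir_deriv_prod_linear) (auto simp: lin)
      finally show "(\<lambda>k. h k * inverse t ^ k) sums
          (dir_deriv u (\<lambda>x. \<Prod>i\<in>I. a i x) (x + t *\<^sub>R e) / (\<Prod>i\<in>I. a i (x + t *\<^sub>R e)))"
        by (simp add: h_def sum_distrib_right mult.assoc)
    qed
  qed
  then show ?thesis
    by (simp add: h_def \<theta>_def)
qed

text \<open>
  The Hermite matrix of a product of linear forms is a combination of the rank one matrices
  \<open>[\<theta>\<^bsup>i+j\<^esup>]\<close>, so the quadratic form is a combination of squares of point evaluations.
\<close>

lemma hermite_map_prod_linear: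
  fixes a :: "'i \<Rightarrow> real ^ 'n \<Rightarrow> real"
  assumes "finite I"
    and "\<And>i. i \<in> I \<Longrightarrow> linear (a i)"
    and "\<And>i. i \<in> I \<Longrightarrow> a i e > 0"
    and y: "y \<in> carrier_vec d"
  shows "hermite_map d (\<lambda>x. \<Prod>i\<in>I. a i x) e x y u
       = (\<Sum>i\<in>I. (\<Sum>j<d. vec_index y j * (- (a i x / a i e)) ^ j)\<^sup>2 * (a i u / a i e))"
proof -
  define \<theta> where "\<theta> i = - (a i x / a i e)" for i
  have "hermite_map d (\<lambda>x. \<Prod>i\<in>I. a i x) e x y u
      = (\<Sum>j<d. vec_index y j * (\<Sum>k<d.
          (\<Sum>i\<in>I. a i u / a i e * \<theta> i ^ (j + k)) * vec_index y k))"
    using y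
    by (simp add: hermite_map_def hermite_matrix_def scalar_prod_def atLeast0LessThan
        hermite_coeffs_prod_linear[OF assms(1-3)] \<theta>_def)
  also have "\<dots> = (\<Sum>j<d. \<Sum>k<d. \<Sum>i\<in>I.
      (vec_index y j * \<theta> i ^ j) * (vec_index y k * \<theta> i ^ k) * (a i u / a i e))"
    by (simp add: sum_distrib_left sum_distrib_right power_add algebra_simps)
  also have "\<dots> = (\<Sum>i\<in>I. \<Sum>j<d. \<Sum>k<d.
      (vec_index y j * \<theta> i ^ j) * (vec_index y k * \<theta> i ^ k) * (a i u / a i e))"
    by (subst sum.swap[of _ I], intro sum.cong refl sum.swap)
  also have "\<dots> = (\<Sum>i\<in>I. (\<Sum>j<d. vec_index y j * \<theta> i ^ j)\<^sup>2 * (a i u / a i e))"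
    by (simp only: power2_eq_square sum_product, simp only: sum_distrib_right)
  finally show ?thesis
    by (simp add: \<theta>_def)
qed

section \<open>The hyperbolicity cone and its dual\<close>

lemma hyperbolicity_cone_prod_linear:
  assumes fin: "finite I"
    and lin: "\<And>i. i \<in> I \<Longrightarrow> linear (a i)"
    and pos: "\<And>i. i \<in> I \<Longrightarrow> a i e > 0"
  shows "hyperbolicity_cone (\<lambda>x. \<Prod>i\<in>I. a i x) e = {x. \<forall>i\<in>I. a i x / a i e \<ge> 0}"
proof -
  have "a i (t *\<^sub>R e - x) = 0 \<longleftrightarrow> t = a i x / a i e" if "i \<in> I" for i t x
    using lin[OF that] pos[OF that] by (auto simp: linear_diff linear_scale field_simps)
  then show ?thesis
    using fin by (auto simp: hyperbolicity_cone_def)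
qed

text \<open>
  The coefficients can be chosen to depend on \<open>b i\<close> only: replace each one by its average over the
  indices carrying the same form.
\<close>

lemma dual_cone_halfspaces:
  fixes b :: "'i \<Rightarrow> real ^ 'n \<Rightarrow> real"
  assumes fin: "finite I" and lin: "\<And>i. i \<in> I \<Longrightarrow> linear (b i)"
    and \<xi>: "\<xi> \<in> dual_cone {x. \<forall>i\<in>I. b i x \<ge> 0}"
  obtains g where "\<And>f. g f \<ge> (0::real)" "\<And>u. \<xi> u = (\<Sum>i\<in>I. g (b i) * b i u)"
proof -
  have "\<forall>i\<in>I. \<exists>v. \<forall>x. b i x = inner v x"
    using lin linear_real_inner by metis
  then obtain v where v: "\<And>i x. i \<in> I \<Longrightarrow> b i x = inner (v i) x"
    by metis
  from \<xi> obtain z where z: "\<And>x. \<xi> x = inner z x"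
    unfolding dual_cone_def using linear_real_inner by blast
  have nonneg: "inner z x \<ge> 0" if "\<And>i. i \<in> I \<Longrightarrow> inner (v i) x \<ge> 0" for x
    using \<xi> that by (auto simp: dual_cone_def z v)
  obtain c where c: "\<And>i. i \<in> I \<Longrightarrow> c i \<ge> 0" and zc: "z = (\<Sum>i\<in>I. c i *\<^sub>R v i)"
    using farkas[OF fin nonneg] by blast
  define J where "J f = {i \<in> I. b i = f}" for f
  define g where "g f = (\<Sum>i\<in>J f. c i) / card (J f)" for f
  have g: "(\<Sum>i\<in>J f. g (b i) * b i u) = (\<Sum>i\<in>J f. c i * b i u)" for f u
  proof (cases "J f = {}")
    case False
    moreover have "finite (J f)"
      using fin by (simp add: J_def)
    moreover have "b i = f" if "i \<in> J f" for i
      using that by (simp add: J_def)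
    ultimately show ?thesis
      by (simp add: g_def sum_distrib_right[symmetric])
  qed simp
  have part: "(\<Sum>i\<in>I. F i) = (\<Sum>f\<in>b ` I. \<Sum>i\<in>J f. F i)" for F :: "'i \<Rightarrow> real"
    unfolding J_def using fin by (rule sum.image_gen)
  show ?thesis
  proof
    show "g f \<ge> 0" for f
      unfolding g_def J_def by (intro divide_nonneg_nonneg sum_nonneg) (auto intro: c)
    have "\<xi> u = (\<Sum>i\<in>I. c i * b i u)" for u
      by (simp add: z zc inner_sum_left v)
    then show "\<xi> u = (\<Sum>i\<in>I. g (b i) * b i u)" for u
      by (simp add: part g)
  qed
qed

theorem proposition7p6:
  fixes p :: "real ^ 'n \<Rightarrow> real" and e :: "real ^ 'n"
    and d :: nat and a :: "nat \<Rightarrow> real ^ 'n \<Rightarrow> real"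
  assumes "p \<in> hyperbolic_polys d e"
    and "\<And>i. i \<in> {1..d} \<Longrightarrow> linear (a i)"
    and "\<And>x. p x = (\<Prod>i = 1..d. a i x)"
    and "\<And>i. i \<in> {1..d} \<Longrightarrow> a i e > 0"
    and "\<And>i j. i \<in> {1..d} \<Longrightarrow> j \<in> {1..d} \<Longrightarrow> i \<noteq> j \<Longrightarrow> a i \<noteq> a j"
  shows "{hermite_map d p e x y | x y. y \<in> carrier_vec d}
       = dual_cone (hyperbolicity_cone p e)"
proof -
  define b where "b i u = a i u / a i e" for i u
  have p: "p = (\<lambda>x. \<Prod>i = 1..d. a i x)"
    using assms(3) by auto
  have lin: "linear (b i)" if "i \<in> {1..d}" for i
    using assms(2)[OF that]
    by (intro linearI) (auto simp: b_def linear_add linear_scale add_divide_distrib)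
  have cone: "hyperbolicity_cone p e = {x. \<forall>i\<in>{1..d}. b i x \<ge> 0}"
    unfolding p b_def by (rule hyperbolicity_cone_prod_linear) (use assms in auto)
  have map: "hermite_map d p e x y u
      = (\<Sum>i = 1..d. (\<Sum>j<d. vec_index y j * (- b i x) ^ j)\<^sup>2 * b i u)"
    if "y \<in> carrier_vec d" for x y u
    unfolding p b_def by (rule hermite_map_prod_linear) (use assms that in auto)
  show ?thesis
  proof (intro equalityI subsetI)
    fix \<xi> assume "\<xi> \<in> {hermite_map d p e x y | x y. y \<in> carrier_vec d}"
    then obtain x y where y: "y \<in> carrier_vec d" and \<xi>: "\<xi> = hermite_map d p e x y"
      by blast
    have eq: "\<xi> = (\<lambda>u. \<Sum>i = 1..d. (\<Sum>j<d. vec_index y j * (- b i x) ^ j)\<^sup>2 * b i u)"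
      unfolding \<xi> map[OF y] by (rule refl)
    have "linear \<xi>"
      unfolding eq
      by (rule linearI) (auto simp: lin linear_add linear_scale sum.distrib[symmetric]
          sum_distrib_left algebra_simps intro!: sum.cong)
    moreover have "\<xi> u \<ge> 0" if "\<forall>i\<in>{1..d}. b i u \<ge> 0" for u
      unfolding eq using that by (intro sum_nonneg mult_nonneg_nonneg) auto
    ultimately show "\<xi> \<in> dual_cone (hyperbolicity_cone p e)"
      unfolding dual_cone_def cone by auto
  next
    fix \<xi> assume "\<xi> \<in> dual_cone (hyperbolicity_cone p e)"
    then obtain g where g: "\<And>f. g f \<ge> 0" and \<xi>: "\<And>u. \<xi> u = (\<Sum>i = 1..d. g (b i) * b i u)"
      using dual_cone_halfspaces[of "{1..d}" b \<xi>] lin unfolding cone by blast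
    have "\<forall>i\<in>{1..d}. \<exists>v. \<forall>x. b i x = inner v x"
      using lin linear_real_inner by metis
    then obtain v where v: "\<And>i x. i \<in> {1..d} \<Longrightarrow> b i x = inner (v i) x"
      by metis
    obtain x where x: "\<And>i j. i \<in> {1..d} \<Longrightarrow> j \<in> {1..d} \<Longrightarrow> inner (v i) x = inner (v j) x \<Longrightarrow> v i = v j"
      using ex_separating_point[of "{1..d}" v] by auto
    have sep: "b i = b j" if "i \<in> {1..d}" "j \<in> {1..d}" "b i x = b j x" for i j
      using x[OF that(1,2)] that by (auto simp: v)
    define A where "A = (\<lambda>i. - b i x) ` {1..d}"
    \<comment> \<open>indices sharing a node \<open>s\<close> share their form by \<open>sep\<close>, so the choice does not matter\<close>
    define F where "F s = sqrt (g (b (SOME i. i \<in> {1..d} \<and> - b i x = s)))" for s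
    have F: "F (- b i x) = sqrt (g (b i))" if "i \<in> {1..d}" for i
    proof -
      define j where "j = (SOME j. j \<in> {1..d} \<and> - b j x = - b i x)"
      have "j \<in> {1..d} \<and> - b j x = - b i x"
        unfolding j_def by (rule someI[of _ i]) (use that in simp)
      then have "b j = b i"
        using that by (intro sep) auto
      then show ?thesis
        by (simp add: F_def j_def)
    qed
    have "finite A" "card A \<le> d"
      unfolding A_def using card_image_le[of "{1..d}" "\<lambda>i. - b i x"] by auto
    then obtain q where q0: "\<And>k. k \<ge> d \<Longrightarrow> coeff q k = 0" and q: "\<And>s. s \<in> A \<Longrightarrow> poly q s = F s"
      using poly_interpolation[of A F] by (meson le_trans)
    define y where "y = Matrix.vec d (coeff q)"
    have y: "y \<in> carrier_vec d"
      by (simp add: y_def)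
    have ev: "(\<Sum>j<d. vec_index y j * s ^ j) = poly q s" for s
    proof -
      have "(\<Sum>j<d. vec_index y j * s ^ j) = (\<Sum>j<d. coeff q j * s ^ j)"
        by (simp add: y_def)
      also have "\<dots> = (\<Sum>j\<le>max d (degree q). coeff q j * s ^ j)"
        by (intro sum.mono_neutral_left) (auto simp: q0)
      also have "\<dots> = (\<Sum>j\<le>degree q. coeff q j * s ^ j)"
        by (intro sum.mono_neutral_right) (auto simp: coeff_eq_0)
      finally show ?thesis
        by (simp add: poly_altdef)
    qed
    have "hermite_map d p e x y u = \<xi> u" for u
      unfolding map[OF y] ev \<xi>
      by (intro sum.cong refl) (simp add: q A_def F g)
    then have "\<xi> = hermite_map d p e x y"
      by auto
    with y show "\<xi> \<in> {hermite_map d p e x y | x y. y \<in> carrier_vec d}"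
      by blast
  qed
qed

end
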